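(* Let $(X,d)$ be a strictly convex linear metric space and let $C\subseteq X$ be a convex subset (i.e. $x,y\in C$ implies $(1-t)x+ty\in C$ for all $t\in[0,1]$). Then $C$ is round in the subspace topology. In particular, every strictly convex linear metric space is round.
   Context: For a metric space $(Y,d)$, $y\in Y$ and $r>0$, write $B_d(y,r)=\{z\in Y: d(y,z)<r\}$ and $B_d[y,r]=\{z\in Y: d(y,z)\le r\}$. The metric $d$ is a round metric for $Y$ if the closure of $B_d(y,r)$ in $Y$ equals $B_d[y,r]$ for all $y\in Y$ and $r>0$. A metrizable space is round if its topology is induced by a round metric. A linear metric space is a topological vector space with a compatible translation invariant metric $d$. A linear metric space $(X,d)$ is strictly convex if for all $r>0$ and all distinct $x,y\in B_d[0,r]$ one has $(x+y)/2\in B_d(0,r)$. *)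

theory Defs
  imports "HOL-Analysis.Analysis"
begin

definition round_metric :: "'a set \<Rightarrow> ('a \<Rightarrow> 'a \<Rightarrow> real) \<Rightarrow> bool" where
  "round_metric Y d \<longleftrightarrow>
     Metric_space Y d \<and>
     (\<forall>y\<in>Y. \<forall>r>0. Metric_space.mtopology Y d closure_of Metric_space.mball Y d y r
                     = Metric_space.mcball Y d y r)"

definition round_space :: "'a topology \<Rightarrow> bool" where
  "round_space T \<longleftrightarrow> (\<exists>d. round_metric (topspace T) d \<and> Metric_space.mtopology (topspace T) d = T)"

(* Scalars are real; a complex topological vector space is in particular a real one. *)
definition topological_vector_space :: "'a::real_vector topology \<Rightarrow> bool" where
  "topological_vector_space T \<longleftrightarrow>
     topspace T = UNIV \<and>
     continuous_map (prod_topology T T) T (\<lambda>(x, y). x + y) \<and>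
     continuous_map (prod_topology euclideanreal T) T (\<lambda>(a, x). a *\<^sub>R x)"

locale linear_metric_space = Metric_space UNIV d
  for d :: "'a::real_vector \<Rightarrow> 'a \<Rightarrow> real" +
  assumes topological_vector_space_mtopology: "topological_vector_space mtopology"
    and translation_invariant: "d (x + z) (y + z) = d x y"

locale strictly_convex_linear_metric_space = linear_metric_space d
  for d :: "'a::real_vector \<Rightarrow> 'a \<Rightarrow> real" +
  assumes midpoint_in_mball:
    "\<lbrakk>r > 0; x \<in> mcball 0 r; y \<in> mcball 0 r; x \<noteq> y\<rbrakk> \<Longrightarrow> (1/2) *\<^sub>R (x + y) \<in> mball 0 r"

end

theory Submission
  imports Defs
begin

text \<open>
  The restriction of \<open>d\<close> to a convex set \<open>C\<close> is itself a round metric. Fix distinct \<open>y\<close> and \<open>z\<close> in \<open>C\<close>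
  and let \<open>x = z - y\<close>. The function \<open>f t = d 0 (t x)\<close> is continuous on \<open>[0,1]\<close>. By strict
  convexity it cannot attain its maximum at an interior point \<open>t\<close>, because \<open>t x\<close> is the midpoint
  of the two distinct points \<open>(t - s) x\<close> and \<open>(t + s) x\<close>, for small \<open>s\<close>, on which \<open>f\<close> is at most
  that maximum. As \<open>f 0 = 0\<close>, the maximum is \<open>f 1\<close>, so \<open>f t < f 1\<close> for \<open>0 < t < 1\<close>. By translation
  invariance the points \<open>y + t x\<close> of the segment from \<open>y\<close> to \<open>z\<close>, which lie in \<open>C\<close>, are thus
  strictly closer to \<open>y\<close> than \<open>z\<close> is, and they converge to \<open>z\<close> as \<open>t\<close> tends to 1. So \<open>z\<close>
  is in the closure of each open ball of \<open>C\<close> around \<open>y\<close> of radius at least \<open>d y z\<close>. The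
  maximum principle is \<open>dist_scaleR_less\<close>, the approximation of \<open>z\<close> is in
  \<open>round_metric_convex\<close>.
\<close>

context linear_metric_space
begin

lemma dist_add_left: "d y (y + x) = d 0 x"
  using translation_invariant[of 0 y x] by (simp add: add.commute)

lemma continuous_on_dist_ray: "continuous_on S (\<lambda>t. d p (t *\<^sub>R x))"
proof -
  have "continuous_map (prod_topology euclideanreal mtopology) mtopology (\<lambda>(a, x). a *\<^sub>R x)"
    using topological_vector_space_mtopology by (simp add: topological_vector_space_def)
  moreover have "continuous_map euclideanreal (prod_topology euclideanreal mtopology) (\<lambda>t. (t, x))"
    by (simp add: continuous_map_pairwise o_def)
  ultimately have "continuous_map euclideanreal mtopology ((\<lambda>(a, x). a *\<^sub>R x) \<circ> (\<lambda>t. (t, x)))"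
    by (rule continuous_map_compose[rotated])
  then have "continuous_map euclideanreal mtopology (\<lambda>t. t *\<^sub>R x)"
    by (simp add: o_def)
  then have "continuous_map euclideanreal euclideanreal (\<lambda>t. d p (t *\<^sub>R x))"
    using continuous_map_mdist[of euclideanreal "metric (UNIV, d)" "\<lambda>t. p" "\<lambda>t. t *\<^sub>R x"]
    by (simp add: mtopology_of_def)
  then show ?thesis
    using continuous_on_subset by auto
qed

end

context strictly_convex_linear_metric_space
begin

text \<open>
  This is a maximum principle: the distance to the origin, restricted to the segment from \<open>0\<close>
  to \<open>x\<close>, has no interior maximum point, since such a point is the midpoint of two others.
\<close>

lemma dist_scaleR_less:
  assumes "x \<noteq> 0" "0 < t" "t < 1"
  shows "d 0 (t *\<^sub>R x) < d 0 x"
proof -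
  obtain m where m: "m \<in> {0..1}" and max: "\<And>s. s \<in> {0..1} \<Longrightarrow> d 0 (s *\<^sub>R x) \<le> d 0 (m *\<^sub>R x)"
    using continuous_attains_sup[OF _ _ continuous_on_dist_ray, of "{0..1::real}" 0 x] by auto
  have interior: "d 0 (s *\<^sub>R x) < d 0 (m *\<^sub>R x)" if s: "0 < s" "s < 1" for s
  proof -
    define e where "e = min s (1 - s)"
    have e: "e > 0" "s - e \<in> {0..1}" "s + e \<in> {0..1}"
      using s by (auto simp: e_def)
    have "0 < d 0 x"
      using \<open>x \<noteq> 0\<close> by simp
    also have "\<dots> \<le> d 0 (m *\<^sub>R x)"
      using max[of 1] by simp
    finally have "(1/2) *\<^sub>R ((s - e) *\<^sub>R x + (s + e) *\<^sub>R x) \<in> mball 0 (d 0 (m *\<^sub>R x))"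
      using e \<open>x \<noteq> 0\<close> by (intro midpoint_in_mball) (auto intro: max)
    moreover have "(1/2) *\<^sub>R ((s - e) *\<^sub>R x + (s + e) *\<^sub>R x) = s *\<^sub>R x"
      by (simp flip: scaleR_left_distrib)
    ultimately show ?thesis
      by simp
  qed
  (* The maximum over the segment is not 0, its value at m = 0, as it exceeds the value at 1/2. *)
  have "m \<noteq> 0"
    using interior[of "1/2"] nonneg[of 0 "(1/2) *\<^sub>R x"] by force
  then have "m = 1"
    using interior[of m] m by force
  then show ?thesis
    using interior assms by simp
qed

text \<open>
  Convexity of \<open>C\<close> keeps the segment from the centre \<open>y\<close> to a point \<open>z\<close> of the closed ball
  inside \<open>C\<close>; by the maximum principle its interior points are in the open ball, and they
  accumulate at \<open>z\<close>.
\<close>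

lemma round_metric_convex:
  assumes "convex C"
  shows "round_metric C d"
proof -
  interpret C: Submetric UNIV d C
    by unfold_locales auto
  have "C.sub.mtopology closure_of C.sub.mball y r = C.sub.mcball y r"
    if "y \<in> C" "r > 0" for y r
  proof
    show "C.sub.mtopology closure_of C.sub.mball y r \<subseteq> C.sub.mcball y r"
      by (intro closure_of_minimal C.sub.mball_subset_mcball C.sub.closedin_mcball)
    show "C.sub.mcball y r \<subseteq> C.sub.mtopology closure_of C.sub.mball y r"
    proof
      fix z assume z: "z \<in> C.sub.mcball y r"
      define x where "x = z - y"
      have yx: "z = y + x"
        by (simp add: x_def)
      have "\<exists>w \<in> C.sub.mball y r. w \<in> C.sub.mball z e" if "e > 0" for e
      proof (cases "x = 0")
        case True
        then show ?thesis
          using that \<open>y \<in> C\<close> \<open>r > 0\<close> yx by (intro bexI[of _ y]) auto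
      next
        case False
        have "((\<lambda>t. d x (t *\<^sub>R x)) \<longlongrightarrow> d x (1 *\<^sub>R x)) (at_left 1)"
          using continuous_on_dist_ray[of UNIV x x] unfolding continuous_on_def
          by (blast intro: filterlim_mono[OF _ order_refl at_le])
        then have "\<forall>\<^sub>F t in at_left 1. d x (t *\<^sub>R x) < e"
          using \<open>e > 0\<close> by (intro order_tendstoD) auto
        moreover have "\<forall>\<^sub>F t in at_left (1::real). t \<in> {0<..<1}"
          by (rule eventually_at_left_real) simp
        ultimately have "\<forall>\<^sub>F t in at_left 1. d x (t *\<^sub>R x) < e \<and> t \<in> {0<..<1}"
          by eventually_elim simp
        then obtain t where t: "d x (t *\<^sub>R x) < e" "0 < t" "t < 1"
          using eventually_happens'[OF trivial_limit_at_left_real] by force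
        let ?w = "y + t *\<^sub>R x"
        have "?w = (1 - t) *\<^sub>R y + t *\<^sub>R z"
          by (simp add: x_def algebra_simps)
        then have "?w \<in> C"
          using convexD_alt[OF assms] \<open>y \<in> C\<close> z t by simp
        moreover have "d y ?w < r"
          using dist_scaleR_less[OF False t(2,3)] z by (simp add: dist_add_left yx)
        moreover have "d z ?w < e"
          using t(1) translation_invariant[of x y "t *\<^sub>R x"] by (simp add: yx add.commute)
        ultimately show ?thesis
          using \<open>y \<in> C\<close> z by (intro bexI[of _ ?w]) auto
      qed
      then show "z \<in> C.sub.mtopology closure_of C.sub.mball y r"
        using z by (auto simp: C.sub.metric_closure_of)
    qed
  qed
  then show ?thesis
    using C.sub.Metric_space_axioms by (simp add: round_metric_def)
qed

lemma round_space_convex: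
  assumes "convex C"
  shows "round_space (subtopology mtopology C)"
proof -
  interpret C: Submetric UNIV d C
    by unfold_locales auto
  show ?thesis
    unfolding round_space_def
    using round_metric_convex[OF assms] C.mtopology_submetric
    by (intro exI[of _ d]) simp
qed

end

theorem theorem3p2:
  fixes d :: "'a::real_vector \<Rightarrow> 'a \<Rightarrow> real"
  assumes "strictly_convex_linear_metric_space d"
  shows "(\<forall>C. convex C \<longrightarrow> round_space (subtopology (Metric_space.mtopology UNIV d) C))
         \<and> round_space (Metric_space.mtopology UNIV d)"
proof -
  interpret strictly_convex_linear_metric_space d
    by (rule assms)
  show ?thesis
    using round_space_convex round_space_convex[OF convex_UNIV] by simp
qed

end
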